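(* Let $\rho$ be a probability density that is uniform on a compact set with non-empty interior in $\mathbb{R}^d$, and let $\mathcal{Y}\subset\mathbb{R}^d$ be a compact set with non-empty interior. Then there does not exist a constant $C>0$ (depending only on $\rho$ and $\mathcal{Y}$) such that for all probability measures $\mu_0,\mu_1$ on $\mathcal{Y}$, $$W_2(\gamma_{\rho\to\mu_0},\gamma_{\rho\to\mu_1})\le C\,W_2(\mu_0,\mu_1),$$ where $\gamma_{\rho\to\mu_i}=(\mathrm{Id},T_{\rho\to\mu_i})_\#\rho$ is the plan induced by the optimal transport map $T_{\rho\to\mu_i}$ from $\rho$ to $\mu_i$ for the quadratic cost.
   Context: $W_2$ is the 2-Wasserstein distance: on the right for the Euclidean distance of $\mathbb{R}^d$, on the left for the Euclidean distance of the product space $\mathbb{R}^d\times\mathbb{R}^d=\mathbb{R}^{2d}$. Since $\rho$ is absolutely continuous and all measures are compactly supported, the quadratic optimal transport map $T_{\rho\to\mu}$ exists and is $\rho$-a.e. unique (Brenier's theorem).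
   Formalization: The dimension is assumed to satisfy d ≥ 2; for d = 1 the claim is false, since the optimal maps are monotone rearrangements and the inequality holds with C = 1. *)

theory Defs
  imports "HOL-Probability.Probability"
begin

definition prob_measures_on :: "'a::topological_space set \<Rightarrow> 'a measure set" where
  "prob_measures_on Y = {\<mu>. sets \<mu> = sets borel \<and> prob_space \<mu> \<and> emeasure \<mu> Y = 1}"

definition couplings :: "'a measure \<Rightarrow> 'b measure \<Rightarrow> ('a \<times> 'b) measure set" where
  "couplings \<mu> \<nu> = {\<pi>. sets \<pi> = sets (\<mu> \<Otimes>\<^sub>M \<nu>) \<and> distr \<pi> \<mu> fst = \<mu> \<and> distr \<pi> \<nu> snd = \<nu>}"

text \<open>
  The infimum is taken in the extended nonnegative reals, and \<open>enn2real\<close> sends \<open>\<infinity>\<close> to 0.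
  This does not matter for compactly supported probability measures: they have the product
  coupling, whose cost is finite.  On a product type \<open>dist\<close> is
  \<open>sqrt ((dist x x')\<^sup>2 + (dist y y')\<^sup>2)\<close>, so for measures on pairs of vectors
  this is the distance for the Euclidean metric of the product space.
\<close>
definition wasserstein2 :: "'a::metric_space measure \<Rightarrow> 'a measure \<Rightarrow> real" where
  "wasserstein2 \<mu> \<nu> =
     sqrt (enn2real (INF \<pi> \<in> couplings \<mu> \<nu>. \<integral>\<^sup>+ (x, y). ennreal ((dist x y)\<^sup>2) \<partial>\<pi>))"

definition transport_maps :: "'a measure \<Rightarrow> 'b measure \<Rightarrow> ('a \<Rightarrow> 'b) set" where
  "transport_maps \<rho> \<mu> = {T \<in> measurable \<rho> \<mu>. distr \<rho> \<mu> T = \<mu>}"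

definition is_optimal_map ::
    "'a::metric_space measure \<Rightarrow> 'a measure \<Rightarrow> ('a \<Rightarrow> 'a) \<Rightarrow> bool" where
  "is_optimal_map \<rho> \<mu> T \<longleftrightarrow>
     T \<in> transport_maps \<rho> \<mu> \<and>
     (\<forall>S \<in> transport_maps \<rho> \<mu>.
        (\<integral>\<^sup>+ x. ennreal ((dist x (T x))\<^sup>2) \<partial>\<rho>) \<le> (\<integral>\<^sup>+ x. ennreal ((dist x (S x))\<^sup>2) \<partial>\<rho>))"

text \<open>
  For \<open>\<rho>\<close> absolutely continuous and compactly supported measures on a Euclidean space,
  Brenier's theorem says that an optimal map exists and is unique up to \<open>\<rho>\<close>-null sets.
  So \<open>SOME\<close> picks a representative of that class, and \<open>optimal_plan\<close> does
  not depend on which one.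
\<close>
definition optimal_map :: "'a::metric_space measure \<Rightarrow> 'a measure \<Rightarrow> 'a \<Rightarrow> 'a" where
  "optimal_map \<rho> \<mu> = (SOME T. is_optimal_map \<rho> \<mu> T)"

definition optimal_plan :: "'a::metric_space measure \<Rightarrow> 'a measure \<Rightarrow> ('a \<times> 'a) measure" where
  "optimal_plan \<rho> \<mu> = distr \<rho> borel (\<lambda>x. (x, optimal_map \<rho> \<mu> x))"

end

theory Submission
  imports Defs
begin

text \<open>
  The target measures sit on two points at distance \<open>2 \<epsilon>\<close>: on \<open>y0 \<plusminus> \<epsilon> e\<close>, and, with the same
  weights, on \<open>y0 \<plusminus> \<epsilon> w\<close> where \<open>w = e + \<epsilon> u\<close> is tilted by an angle of order \<open>\<epsilon>\<close>.  So the
  distance between them is at most \<open>\<epsilon>\<^sup>2\<close>.  The optimal maps cut \<open>\<rho>\<close> by hyperplanes orthogonal to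
  \<open>e\<close> and \<open>w\<close>, hence a set of mass of order \<open>\<epsilon>\<close>, at distance of order \<open>\<epsilon>\<close> from the first
  hyperplane, lies on different sides of the two cuts.  A coupling of the plans must either move
  this mass across the first hyperplane or exchange the two target points; both cost a squared
  distance of order \<open>\<epsilon>\<^sup>2\<close>.  So the squared distance of the plans is at least of order \<open>\<epsilon>\<^sup>3\<close>,
  against \<open>\<epsilon>\<^sup>4\<close> for the targets.
\<close>

section \<open>Bounds on \<open>wasserstein2\<close> through couplings\<close>

lemma wasserstein2_le:
  assumes "\<pi> \<in> couplings \<mu> \<nu>" "(\<integral>\<^sup>+ (x, y). ennreal ((dist x y)\<^sup>2) \<partial>\<pi>) \<le> ennreal (r\<^sup>2)" "r \<ge> 0"
  shows "wasserstein2 \<mu> \<nu> \<le> r"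
proof -
  have "(INF \<pi> \<in> couplings \<mu> \<nu>. \<integral>\<^sup>+ (x, y). ennreal ((dist x y)\<^sup>2) \<partial>\<pi>) \<le> ennreal (r\<^sup>2)"
    using assms(1,2) by (rule INF_lower2)
  then have "enn2real (INF \<pi> \<in> couplings \<mu> \<nu>. \<integral>\<^sup>+ (x, y). ennreal ((dist x y)\<^sup>2) \<partial>\<pi>) \<le> r\<^sup>2"
    by (simp add: enn2real_leI)
  then show ?thesis
    unfolding wasserstein2_def using assms(3) by (rule real_le_lsqrt[rotated])
qed

text \<open>One coupling of finite cost has to be exhibited: with an infinite infimum,
  \<open>enn2real\<close> would return 0 and the lower bound on the costs would be lost.\<close>

lemma le_wasserstein2:
  assumes "\<And>\<pi>. \<pi> \<in> couplings \<mu> \<nu> \<Longrightarrow> ennreal (r\<^sup>2) \<le> (\<integral>\<^sup>+ (x, y). ennreal ((dist x y)\<^sup>2) \<partial>\<pi>)"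
    and "\<pi> \<in> couplings \<mu> \<nu>" "(\<integral>\<^sup>+ (x, y). ennreal ((dist x y)\<^sup>2) \<partial>\<pi>) < \<infinity>"
  shows "r \<le> wasserstein2 \<mu> \<nu>"
proof -
  let ?I = "INF \<pi> \<in> couplings \<mu> \<nu>. \<integral>\<^sup>+ (x, y). ennreal ((dist x y)\<^sup>2) \<partial>\<pi>"
  have 1: "ennreal (r\<^sup>2) \<le> ?I"
    using assms(1) by (rule INF_greatest)
  have "?I < \<infinity>"
    using INF_lower[OF assms(2)] assms(3) by (rule le_less_trans)
  then have "r\<^sup>2 \<le> enn2real ?I"
    using enn2real_mono[OF 1] by simp
  then show ?thesis
    unfolding wasserstein2_def by (rule real_le_rsqrt)
qed

text \<open>Two images of one measure are coupled by sharing the source point. This serves for the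
  upper bound between the targets and for the finite cost between the plans.\<close>

lemma distr_pair_in_couplings:
  assumes [measurable]: "f \<in> borel_measurable M" "g \<in> borel_measurable M"
  shows "distr M (distr M borel f \<Otimes>\<^sub>M distr M borel g) (\<lambda>x. (f x, g x))
    \<in> couplings (distr M borel f) (distr M borel g)"
proof -
  let ?P = "distr M borel f \<Otimes>\<^sub>M distr M borel g"
  have [measurable]: "(\<lambda>x. (f x, g x)) \<in> measurable M ?P"
    by (rule measurable_Pair) (auto simp: measurable_distr_eq2)
  have "distr (distr M ?P (\<lambda>x. (f x, g x))) (distr M borel f) fst = distr M (distr M borel f) f"
    by (subst distr_distr) (auto simp: comp_def)
  moreover have "distr (distr M ?P (\<lambda>x. (f x, g x))) (distr M borel g) snd = distr M (distr M borel g) g"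
    by (subst distr_distr) (auto simp: comp_def)
  moreover have "distr M (distr M borel f) f = distr M borel f" "distr M (distr M borel g) g = distr M borel g"
    by (auto intro: distr_cong)
  ultimately show ?thesis by (simp add: couplings_def)
qed

lemma nn_integral_distr_pair_cost:
  fixes f g :: "'a \<Rightarrow> 'b::{second_countable_topology, metric_space}"
  assumes [measurable]: "f \<in> borel_measurable M" "g \<in> borel_measurable M"
  shows "(\<integral>\<^sup>+ (x, y). ennreal ((dist x y)\<^sup>2)
      \<partial>distr M (distr M borel f \<Otimes>\<^sub>M distr M borel g) (\<lambda>x. (f x, g x)))
    = (\<integral>\<^sup>+ x. ennreal ((dist (f x) (g x))\<^sup>2) \<partial>M)"
proof -
  let ?P = "distr M borel f \<Otimes>\<^sub>M distr M borel g"
  \<comment> \<open>Second countability enters here: the product of the Borel sigma-algebras is the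
    Borel sigma-algebra of the product, so the squared distance is measurable.\<close>
  have P: "sets ?P = sets (borel :: ('b \<times> 'b) measure)"
    by (metis borel_prod sets_distr sets_pair_measure_cong)
  have [measurable]: "(\<lambda>x. (f x, g x)) \<in> measurable M ?P"
    by (rule measurable_Pair) (auto simp: measurable_distr_eq2)
  have "(\<lambda>(x, y). ennreal ((dist x y)\<^sup>2)) \<in> borel_measurable (borel :: ('b \<times> 'b) measure)"
    unfolding borel_prod[symmetric] by measurable
  then have "(\<lambda>(x, y). ennreal ((dist x y)\<^sup>2)) \<in> borel_measurable ?P"
    using measurable_cong_sets[OF P refl] by blast
  then show ?thesis
    by (subst nn_integral_distr) (auto simp: case_prod_beta)
qed

text \<open>Almost every pair under \<open>\<pi>\<close> consists of a point on the graph of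
  \<open>T0\<close> and one on the graph of \<open>T1\<close>. The second has its base point in
  \<open>R\<close> with mass \<open>emeasure \<rho> R\<close>, and \<open>far\<close> holds for
  every partner \<open>x\<close>, so it is irrelevant how \<open>\<pi>\<close> matches the
  points.\<close>

lemma coupling_cost_ge:
  fixes T0 T1 :: "'a \<Rightarrow> 'a::{second_countable_topology, metric_space}"
  assumes S: "sets \<rho> = sets borel"
    and [measurable]: "T0 \<in> borel_measurable \<rho>" "T1 \<in> borel_measurable \<rho>" "R \<in> sets \<rho>"
    and far: "\<And>x x'. x' \<in> R \<Longrightarrow> s \<le> dist (x, T0 x) (x', T1 x')" and "s \<ge> 0"
    and \<pi>: "\<pi> \<in> couplings (distr \<rho> borel (\<lambda>x. (x, T0 x))) (distr \<rho> borel (\<lambda>x. (x, T1 x)))"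
  shows "ennreal (s\<^sup>2) * emeasure \<rho> R \<le> (\<integral>\<^sup>+ (p, q). ennreal ((dist p q)\<^sup>2) \<partial>\<pi>)"
proof -
  let ?g0 = "distr \<rho> borel (\<lambda>x. (x, T0 x))" and ?g1 = "distr \<rho> borel (\<lambda>x. (x, T1 x))"
  have id_meas[measurable]: "(\<lambda>x. x) \<in> borel_measurable \<rho>"
    using measurable_ident_sets[OF S] by simp
  have T0'[measurable]: "T0 \<in> borel_measurable borel" and T1'[measurable]: "T1 \<in> borel_measurable borel"
    using assms(2,3) S by (simp_all cong: measurable_cong_sets)
  have [measurable]: "(\<lambda>x. (x, T0 x)) \<in> borel_measurable \<rho>" "(\<lambda>x. (x, T1 x)) \<in> borel_measurable \<rho>"
    by (intro borel_measurable_Pair id_meas assms)+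
  have R'[measurable]: "R \<in> sets borel" using assms(4) S by simp
  have s\<pi>: "sets \<pi> = sets (?g0 \<Otimes>\<^sub>M ?g1)" and f\<pi>: "distr \<pi> ?g0 fst = ?g0" and g\<pi>: "distr \<pi> ?g1 snd = ?g1"
    using \<pi> by (auto simp: couplings_def)
  have mf[measurable]: "fst \<in> measurable \<pi> ?g0" and ms[measurable]: "snd \<in> measurable \<pi> ?g1"
    using measurable_cong_sets[OF s\<pi> refl] measurable_fst measurable_snd by blast+
  have [measurable]: "fst \<in> borel_measurable (borel :: ('a\<times>'a) measure)"
      "snd \<in> borel_measurable (borel :: ('a\<times>'a) measure)"
    unfolding borel_prod[symmetric] by measurable
  have "AE p in ?g0. snd p = T0 (fst p)"
    by (subst AE_distr_iff) auto
  then have A0: "AE z in \<pi>. snd (fst z) = T0 (fst (fst z))"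
    by (intro AE_distrD[OF mf]) (unfold f\<pi>)
  have "AE p in ?g1. snd p = T1 (fst p)"
    by (subst AE_distr_iff) auto
  then have A1: "AE z in \<pi>. snd (snd z) = T1 (fst (snd z))"
    by (intro AE_distrD[OF ms]) (unfold g\<pi>)
  have RU: "R \<times> UNIV \<in> sets ?g1"
    using borel_Times[OF R', of UNIV] by simp
  let ?Z = "snd -` (R \<times> UNIV) \<inter> space \<pi>"
  have Z: "?Z \<in> sets \<pi>" using measurable_sets[OF ms RU] .
  have "emeasure \<rho> R = emeasure ?g1 (R \<times> UNIV)"
    using RU by (subst emeasure_distr) (auto intro!: arg_cong[where f="emeasure \<rho>"]
        dest: sets.sets_into_space[OF assms(4), THEN subsetD])
  also have "\<dots> = emeasure \<pi> ?Z"
    using emeasure_distr[OF ms RU] unfolding g\<pi> .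
  finally have "ennreal (s\<^sup>2) * emeasure \<rho> R = (\<integral>\<^sup>+ z. ennreal (s\<^sup>2) * indicator ?Z z \<partial>\<pi>)"
    using Z by (simp add: nn_integral_cmult_indicator)
  also have "\<dots> \<le> (\<integral>\<^sup>+ z. ennreal ((dist (fst z) (snd z))\<^sup>2) \<partial>\<pi>)"
  proof (rule nn_integral_mono_AE)
    show "AE z in \<pi>. ennreal (s\<^sup>2) * indicator ?Z z \<le> ennreal ((dist (fst z) (snd z))\<^sup>2)"
      using A0 A1
    proof eventually_elim
      case (elim z)
      show ?case
      proof (cases "z \<in> ?Z")
        case True
        then have "fst (snd z) \<in> R" by auto
        from far[OF this, of "fst (fst z)"] have "s \<le> dist (fst z) (snd z)"
          using elim by (metis prod.collapse)
        then show ?thesis using True \<open>s \<ge> 0\<close> by (auto intro!: ennreal_leI power_mono)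
      qed auto
    qed
  qed
  finally show ?thesis by (simp add: case_prod_unfold)
qed

section \<open>Hyperplane cuts as optimal maps onto two points\<close>

text \<open>When \<open>b - a\<close> is a positive multiple of \<open>w\<close>, this is the form
  of an optimal map onto a measure carried by \<open>a\<close> and \<open>b\<close>;
  \<open>c\<close> fixes how the mass is shared.\<close>

definition cut_map :: "'a::real_inner \<Rightarrow> real \<Rightarrow> 'a \<Rightarrow> 'a \<Rightarrow> 'a \<Rightarrow> 'a" where
  "cut_map w c a b x = (if x \<bullet> w \<le> c then a else b)"

lemma borel_measurable_cut_map [measurable]:
  "cut_map w c a b \<in> borel_measurable (borel :: 'a::euclidean_space measure)"
  unfolding cut_map_def by measurable

text \<open>The image only sees the mass sent to each value, so a half-space may be replaced by a
  tilted one of equal mass.\<close>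

lemma distr_two_valued_cong:
  assumes "finite_measure M" and [measurable]: "Measurable.pred M P" "Measurable.pred M Q"
    and eq: "measure M {x \<in> space M. P x} = measure M {x \<in> space M. Q x}"
  shows "distr M borel (\<lambda>x. if P x then a else b) = distr M borel (\<lambda>x. if Q x then a else b)"
proof (rule measure_eqI)
  interpret finite_measure M by fact
  fix X assume "X \<in> sets (distr M borel (\<lambda>x. if P x then a else b))"
  then have [measurable]: "X \<in> sets borel" by simp
  have pre: "(\<lambda>x. if B x then a else b) -` X \<inter> space M =
    (if a \<in> X then if b \<in> X then space M else {x \<in> space M. B x}
     else if b \<in> X then space M - {x \<in> space M. B x} else {})" for B
    by (auto split: if_splits)
  have "emeasure M (space M - {x \<in> space M. P x}) = emeasure M (space M - {x \<in> space M. Q x})"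
    using eq by (simp add: emeasure_eq_measure measure_Diff)
  moreover have "emeasure M {x \<in> space M. P x} = emeasure M {x \<in> space M. Q x}"
    using eq by (simp add: emeasure_eq_measure)
  ultimately show "emeasure (distr M borel (\<lambda>x. if P x then a else b)) X =
      emeasure (distr M borel (\<lambda>x. if Q x then a else b)) X"
    by (simp add: emeasure_distr pre)
qed simp

text \<open>The weight \<open>\<kappa>\<close> realizes the half-space as a Laguerre cell: \<open>cut_map\<close> minimizes
  \<open>(dist x y)\<^sup>2 - \<psi> y\<close> pointwise over the two targets, where \<open>\<psi> a = \<kappa>\<close> and \<open>\<psi> b = 0\<close>.\<close>
lemma cut_map_weighted_cost:
  fixes x :: "'a::real_inner" and \<psi> :: "'a \<Rightarrow> real"
  assumes "t > 0" "b = a + t *\<^sub>R w" "\<kappa> = 2 * t * c + a \<bullet> a - b \<bullet> b"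
    and \<psi>: "\<psi> = (\<lambda>y. if y = a then \<kappa> else 0)" and "y = a \<or> y = b"
  shows "(dist x (cut_map w c a b x))\<^sup>2 - \<psi> (cut_map w c a b x) \<le> (dist x y)\<^sup>2 - \<psi> y"
    and "x \<bullet> w \<noteq> c \<Longrightarrow> (dist x (cut_map w c a b x))\<^sup>2 - \<psi> (cut_map w c a b x) = (dist x y)\<^sup>2 - \<psi> y
      \<Longrightarrow> y = cut_map w c a b x"
proof -
  \<comment> \<open>The terms quadratic in \<open>x\<close> cancel, so the two weighted costs differ
    by an affine function of \<open>x\<close>; \<open>\<kappa>\<close> is chosen to make it vanish
    on the hyperplane.\<close>
  have key: "(dist x b)\<^sup>2 - (dist x a)\<^sup>2 + \<kappa> = 2 * t * (c - x \<bullet> w)"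
    unfolding dist_norm power2_norm_eq_inner assms(3) unfolding assms(2)
    by (simp add: inner_simps inner_commute algebra_simps)
  have "2 * t * (c - x \<bullet> w) \<ge> 0" if "x \<bullet> w \<le> c" using assms(1) that by simp
  moreover have "2 * t * (c - x \<bullet> w) < 0" if "\<not> x \<bullet> w \<le> c"
    using assms(1) that by (simp add: mult_pos_neg)
  ultimately show "(dist x (cut_map w c a b x))\<^sup>2 - \<psi> (cut_map w c a b x) \<le> (dist x y)\<^sup>2 - \<psi> y"
    using key assms(5) unfolding \<psi> cut_map_def by (smt (verit, best))
  show "y = cut_map w c a b x" if "x \<bullet> w \<noteq> c"
    "(dist x (cut_map w c a b x))\<^sup>2 - \<psi> (cut_map w c a b x) = (dist x y)\<^sup>2 - \<psi> y"
  proof -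
    have "2 * t * (c - x \<bullet> w) \<noteq> 0" using assms(1) that(1) by simp
    then show ?thesis using key that(2) assms(5) unfolding \<psi> cut_map_def by (smt (verit, best))
  qed
qed

text \<open>Both integrals of \<open>\<psi>\<close> along a transport map equal \<open>\<integral>\<psi> d\<mu>\<close>, so the pointwise minimality of
  the weighted cost gives optimality, and its strictness off the hyperplane gives uniqueness.\<close>
lemma cut_map_optimal:
  fixes \<rho> :: "'a::euclidean_space measure"
  assumes "prob_space \<rho>" and S: "sets \<rho> = sets borel"
    and bdd: "AE x in \<rho>. norm x \<le> B" and off: "AE x in \<rho>. x \<bullet> w \<noteq> c"
    and t: "t > 0" "b = a + t *\<^sub>R w"
    and \<mu>: "\<mu> = distr \<rho> borel (cut_map w c a b)"
  shows "is_optimal_map \<rho> \<mu> (cut_map w c a b)"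
    and "is_optimal_map \<rho> \<mu> T \<Longrightarrow> AE x in \<rho>. T x = cut_map w c a b x"
proof -
  interpret prob_space \<rho> by fact
  define \<psi> where "\<psi> = (\<lambda>y. if y = a then 2 * t * c + a \<bullet> a - b \<bullet> b else 0)"
  have \<psi>_meas[measurable]: "\<psi> \<in> borel_measurable borel" unfolding \<psi>_def by measurable
  note opt = cut_map_weighted_cost[OF t refl \<psi>_def]
  have id_meas[measurable]: "(\<lambda>x. x) \<in> borel_measurable \<rho>"
    using measurable_ident_sets[OF S] by simp
  let ?T = "cut_map w c a b"
  have T[measurable]: "?T \<in> borel_measurable \<rho>"
    using borel_measurable_cut_map S by (simp cong: measurable_cong_sets)
  define D :: "('a \<Rightarrow> 'a) \<Rightarrow> 'a \<Rightarrow> real" where "D = (\<lambda>U (x::'a). (dist x (U x))\<^sup>2)"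
  have tm: "?T \<in> transport_maps \<rho> \<mu>"
    unfolding transport_maps_def \<mu> by (auto intro: distr_cong)
  have *: "(\<integral>\<^sup>+x. ennreal (D U x) \<partial>\<rho>) = ennreal (\<integral>x. D U x \<partial>\<rho>) \<and>
      (AE x in \<rho>. D ?T x - \<psi> (?T x) \<le> D U x - \<psi> (U x)) \<and>
      integrable \<rho> (\<lambda>x. D U x - \<psi> (U x)) \<and>
      (\<integral>x. D U x - \<psi> (U x) \<partial>\<rho>) = (\<integral>x. D U x \<partial>\<rho>) - (\<integral>y. \<psi> y \<partial>\<mu>) \<and> (AE x in \<rho>. U x = a \<or> U x = b)"
    if U: "U \<in> transport_maps \<rho> \<mu>" for U
  proof -
    have U1: "U \<in> measurable \<rho> \<mu>" and U2: "distr \<rho> \<mu> U = \<mu>"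
      using U by (auto simp: transport_maps_def)
    have [measurable]: "U \<in> borel_measurable \<rho>" using U1 by (simp add: \<mu>)
    \<comment> \<open>Any transport map takes only the values \<open>a\<close> and \<open>b\<close>
      almost everywhere, so the pointwise comparison applies to it. Its cost is then bounded, hence
      integrable, and \<open>\<psi>\<close> can be subtracted in the reals.\<close>
    have "AE y in \<mu>. y = a \<or> y = b"
      unfolding \<mu> by (subst AE_distr_iff) (auto simp: cut_map_def)
    then have ab: "AE x in \<rho>. U x = a \<or> U x = b"
      by (intro AE_distrD[OF U1]) (unfold U2)
    have "AE x in \<rho>. norm (D U x) \<le> (B + max (norm a) (norm b))\<^sup>2"
      using ab bdd
    proof eventually_elim
      case (elim x)
      have "dist x (U x) \<le> norm x + norm (U x)" by (simp add: dist_norm norm_triangle_ineq4)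
      also have "\<dots> \<le> B + max (norm a) (norm b)" using elim by auto
      finally show ?case unfolding D_def by (simp add: power_mono)
    qed
    then have i1: "integrable \<rho> (D U)"
      by (rule integrable_const_bound) (simp add: D_def)
    have i2: "integrable \<rho> (\<lambda>x. \<psi> (U x))"
      by (rule integrable_const_bound[where B="\<bar>2 * t * c + a \<bullet> a - b \<bullet> b\<bar>"]) (auto simp: \<psi>_def)
    have "(\<integral>x. \<psi> (U x) \<partial>\<rho>) = (\<integral>y. \<psi> y \<partial>distr \<rho> \<mu> U)"
      using U1 by (subst integral_distr) (auto simp: \<mu>)
    then have e: "(\<integral>x. \<psi> (U x) \<partial>\<rho>) = (\<integral>y. \<psi> y \<partial>\<mu>)" by (simp add: U2)
    have "AE x in \<rho>. D ?T x - \<psi> (?T x) \<le> D U x - \<psi> (U x)"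
      using ab opt(1) by (auto simp: D_def)
    moreover have "(\<integral>\<^sup>+x. ennreal (D U x) \<partial>\<rho>) = ennreal (\<integral>x. D U x \<partial>\<rho>)"
      using i1 by (intro nn_integral_eq_integral) (auto simp: D_def)
    ultimately show ?thesis using i1 i2 e ab by simp
  qed
  note T0 = *[OF tm]
  show opt_T: "is_optimal_map \<rho> \<mu> ?T"
    unfolding is_optimal_map_def
  proof (intro conjI ballI tm)
    fix U assume "U \<in> transport_maps \<rho> \<mu>"
    note U = *[OF this]
    have "(\<integral>x. D ?T x - \<psi> (?T x) \<partial>\<rho>) \<le> (\<integral>x. D U x - \<psi> (U x) \<partial>\<rho>)"
      using T0 U by (intro integral_mono_AE) auto
    then have "(\<integral>\<^sup>+x. ennreal (D ?T x) \<partial>\<rho>) \<le> (\<integral>\<^sup>+x. ennreal (D U x) \<partial>\<rho>)"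
      using T0 U by (simp add: ennreal_leI)
    then show "(\<integral>\<^sup>+x. ennreal ((dist x (?T x))\<^sup>2) \<partial>\<rho>) \<le> (\<integral>\<^sup>+x. ennreal ((dist x (U x))\<^sup>2) \<partial>\<rho>)"
      by (simp add: D_def)
  qed
  show "AE x in \<rho>. T x = ?T x" if "is_optimal_map \<rho> \<mu> T"
  proof -
    have T: "T \<in> transport_maps \<rho> \<mu>" using that by (simp add: is_optimal_map_def)
    note U = *[OF this]
    have "(\<integral>\<^sup>+x. ennreal (D T x) \<partial>\<rho>) \<le> (\<integral>\<^sup>+x. ennreal (D ?T x) \<partial>\<rho>)"
      using that tm by (simp add: is_optimal_map_def D_def)
    then have "(\<integral>x. D T x \<partial>\<rho>) \<le> (\<integral>x. D ?T x \<partial>\<rho>)"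
      using T0 U by (simp add: D_def)
    \<comment> \<open>The integrals of \<open>\<psi>\<close> cancel, turning the comparison of costs
      into one of weighted costs. The integrand is nonnegative almost everywhere, so it vanishes
      almost everywhere.\<close>
    then have le: "(\<integral>x. (D T x - \<psi> (T x)) - (D ?T x - \<psi> (?T x)) \<partial>\<rho>) \<le> 0"
      using T0 U by simp
    have pos: "AE x in \<rho>. 0 \<le> (D T x - \<psi> (T x)) - (D ?T x - \<psi> (?T x))"
      using U by auto
    have "(\<integral>x. (D T x - \<psi> (T x)) - (D ?T x - \<psi> (?T x)) \<partial>\<rho>) = 0"
      using le integral_nonneg_AE[OF pos] by linarith
    then have "AE x in \<rho>. (D T x - \<psi> (T x)) - (D ?T x - \<psi> (?T x)) = 0"
      using T0 U pos by (subst (asm) integral_nonneg_eq_0_iff_AE) auto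
    moreover have "AE x in \<rho>. T x = a \<or> T x = b" using U by simp
    ultimately show ?thesis
      using off
    proof eventually_elim
      case (elim x)
      then show ?case using opt(2)[of "T x" x] by (auto simp: D_def)
    qed
  qed
qed

text \<open>The cut is a witness for the choice in \<open>optimal_map\<close>, so the chosen map is
  optimal; by uniqueness it agrees with the cut almost everywhere, and the plans coincide.\<close>

lemma optimal_plan_cut_map:
  fixes \<rho> :: "'a::euclidean_space measure"
  assumes "prob_space \<rho>" and S: "sets \<rho> = sets borel"
    and bdd: "AE x in \<rho>. norm x \<le> B" and off: "AE x in \<rho>. x \<bullet> w \<noteq> c"
    and t: "t > 0" "b = a + t *\<^sub>R w"
    and \<mu>: "\<mu> = distr \<rho> borel (cut_map w c a b)"
  shows "optimal_plan \<rho> \<mu> = distr \<rho> borel (\<lambda>x. (x, cut_map w c a b x))"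
proof -
  note o = cut_map_optimal[OF assms]
  have opt: "is_optimal_map \<rho> \<mu> (optimal_map \<rho> \<mu>)"
    unfolding optimal_map_def by (rule someI[where P="is_optimal_map \<rho> \<mu>", OF o(1)])
  have [measurable]: "optimal_map \<rho> \<mu> \<in> borel_measurable \<rho>" "cut_map w c a b \<in> borel_measurable \<rho>"
    using opt o(1) by (auto simp: is_optimal_map_def transport_maps_def \<mu>)
  have id_meas[measurable]: "(\<lambda>x. x) \<in> borel_measurable \<rho>"
    using measurable_ident_sets[OF S] by simp
  show ?thesis
    unfolding optimal_plan_def
    by (rule distr_cong_AE) (use o(2)[OF opt] in \<open>auto intro!: borel_measurable_Pair\<close>)
qed

section \<open>Two tilted cuts: equal masses, distances of targets and plans, mass between the
  cuts\<close>

text \<open>Since hyperplanes orthogonal to \<open>w\<close> are null sets, the distribution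
  function of \<open>x \<bullet> w\<close> is continuous with limits 0 and 1, and the intermediate
  value theorem gives the level.\<close>

lemma exists_halfspace_measure:
  fixes \<rho> :: "'a::euclidean_space measure"
  assumes "prob_space \<rho>" and S: "sets \<rho> = sets borel"
    and off: "\<And>c. AE x in \<rho>. x \<bullet> w \<noteq> c" and m: "0 < m" "m < 1"
  obtains c where "measure \<rho> {x \<in> space \<rho>. x \<bullet> w \<le> c} = m"
proof -
  interpret prob_space \<rho> by fact
  have id_meas[measurable]: "(\<lambda>x. x) \<in> borel_measurable \<rho>"
    using measurable_ident_sets[OF S] by simp
  let ?D = "distr \<rho> borel (\<lambda>x. x \<bullet> w)"
  have f[measurable]: "(\<lambda>x. x \<bullet> w) \<in> borel_measurable \<rho>" by measurable
  interpret D: real_distribution ?D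
    by (rule real_distribution_distr) simp
  have "measure ?D {c} = 0" for c
  proof -
    have "measure ?D {c} = measure \<rho> {x \<in> space \<rho>. x \<bullet> w = c}"
      by (subst measure_distr) (auto intro!: arg_cong[where f="measure \<rho>"])
    also have "\<dots> = 0" using off[of c] by (subst prob_eq_0) auto
    finally show ?thesis .
  qed
  then have cont: "isCont (cdf ?D) c" for c
    by (simp add: D.isCont_cdf)
  have "eventually (\<lambda>c. cdf ?D c < m) at_bot"
    using D.cdf_lim_at_bot m(1) by (rule order_tendstoD)
  then obtain l where l: "cdf ?D l < m" by (auto simp: eventually_at_bot_linorder)
  have "eventually (\<lambda>c. cdf ?D c > m) at_top"
    using D.cdf_lim_at_top_prob m(2) by (rule order_tendstoD)
  then obtain h where h: "cdf ?D h > m" "h \<ge> l" unfolding eventually_at_top_linorder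
    by (meson linorder_le_cases order_refl)
  have "\<exists>c. l \<le> c \<and> c \<le> h \<and> cdf ?D c = m"
    using l h cont by (intro IVT) auto
  then obtain c where "cdf ?D c = m" by auto
  moreover have "cdf ?D c = measure \<rho> {x \<in> space \<rho>. x \<bullet> w \<le> c}"
    unfolding cdf_def by (subst measure_distr) (auto intro!: arg_cong[where f="measure \<rho>"])
  ultimately show ?thesis using that by metis
qed

text \<open>By the equal masses, the second target is also the image under the first cut with the
  values \<open>a'\<close> and \<open>b'\<close>. Sharing the source point then couples
  \<open>a\<close> with \<open>a'\<close> and \<open>b\<close> with \<open>b'\<close>.\<close>

lemma wasserstein2_two_point_le:
  fixes \<rho> :: "'a::euclidean_space measure"
  assumes "prob_space \<rho>" and S: "sets \<rho> = sets borel"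
    and m: "measure \<rho> {x. x \<bullet> w \<le> c} = measure \<rho> {x. x \<bullet> w' \<le> c'}"
    and d: "dist a a' \<le> r" "dist b b' \<le> r"
  shows "wasserstein2 (distr \<rho> borel (cut_map w c a b)) (distr \<rho> borel (cut_map w' c' a' b')) \<le> r"
proof -
  interpret prob_space \<rho> by fact
  have sp: "space \<rho> = UNIV" using sets_eq_imp_space_eq[OF S] by simp
  have [measurable]: "cut_map w c a b \<in> borel_measurable \<rho>" for w c a and b :: 'a
    using borel_measurable_cut_map S by (simp cong: measurable_cong_sets)
  have id_meas[measurable]: "(\<lambda>x. x) \<in> borel_measurable \<rho>"
    using measurable_ident_sets[OF S] by simp
  have e: "distr \<rho> borel (cut_map w' c' a' b') = distr \<rho> borel (cut_map w c a' b')"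
    unfolding cut_map_def by (rule distr_two_valued_cong) (use m in \<open>auto simp: sp finite_measure_axioms\<close>)
  have r: "r \<ge> 0" using d(1) zero_le_dist order_trans by blast
  show ?thesis
    unfolding e
  proof (rule wasserstein2_le[OF distr_pair_in_couplings])
    have "(\<integral>\<^sup>+ x. ennreal ((dist (cut_map w c a b x) (cut_map w c a' b' x))\<^sup>2) \<partial>\<rho>)
        \<le> (\<integral>\<^sup>+ x. ennreal (r\<^sup>2) \<partial>\<rho>)"
      using d by (intro nn_integral_mono ennreal_leI power_mono) (auto simp: cut_map_def)
    then show "(\<integral>\<^sup>+ (x, y). ennreal ((dist x y)\<^sup>2)
        \<partial>distr \<rho> (distr \<rho> borel (cut_map w c a b) \<Otimes>\<^sub>M distr \<rho> borel (cut_map w c a' b'))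
          (\<lambda>x. (cut_map w c a b x, cut_map w c a' b' x))) \<le> ennreal (r\<^sup>2)"
      by (subst nn_integral_distr_pair_cost) (auto simp: emeasure_space_1)
  qed (use r in auto)
qed

text \<open>Points of \<open>R\<close> lie at distance at least \<open>s\<close> from the first half-space carrying the same label,
  and changing the label costs at least \<open>s\<close> as well.\<close>
lemma wasserstein2_cut_plans_ge:
  fixes \<rho> :: "'a::euclidean_space measure"
  assumes "prob_space \<rho>" and S: "sets \<rho> = sets borel" and "R \<in> sets borel"
    and e: "norm e \<le> 1" and s: "s \<ge> 0" "s \<le> dist a b'" "s \<le> dist b a'"
    and R: "(\<forall>x\<in>R. x \<bullet> w > c' \<and> x \<bullet> e \<le> c - s) \<or> (\<forall>x\<in>R. x \<bullet> w \<le> c' \<and> x \<bullet> e \<ge> c + s)"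
  shows "s * sqrt (measure \<rho> R) \<le> wasserstein2 (distr \<rho> borel (\<lambda>x. (x, cut_map e c a b x)))
      (distr \<rho> borel (\<lambda>x. (x, cut_map w c' a' b' x)))"
proof -
  interpret prob_space \<rho> by fact
  have id_meas[measurable]: "(\<lambda>x. x) \<in> borel_measurable \<rho>"
    using measurable_ident_sets[OF S] by simp
  have cm[measurable]: "cut_map w c a b \<in> borel_measurable \<rho>" for w c a and b :: 'a
    using borel_measurable_cut_map S by (simp cong: measurable_cong_sets)
  have pm: "(\<lambda>x. (x, cut_map w c a b x)) \<in> borel_measurable \<rho>" for w c a and b :: 'a
    by (intro borel_measurable_Pair id_meas cm)
  show ?thesis
  proof (rule le_wasserstein2[OF _ distr_pair_in_couplings[OF pm pm]])
    fix \<pi> assume \<pi>: "\<pi> \<in> couplings (distr \<rho> borel (\<lambda>x. (x, cut_map e c a b x)))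
      (distr \<rho> borel (\<lambda>x. (x, cut_map w c' a' b' x)))"
    have far: "s \<le> dist (x, cut_map e c a b x) (x', cut_map w c' a' b' x')" if "x' \<in> R" for x x'
    proof -
      have 1: "\<bar>x \<bullet> e - x' \<bullet> e\<bar> \<le> dist x x'"
      proof -
        have "\<bar>(x - x') \<bullet> e\<bar> \<le> norm (x - x') * norm e" by (rule Cauchy_Schwarz_ineq2)
        also have "\<dots> \<le> norm (x - x') * 1" using e by (intro mult_left_mono) auto
        finally show ?thesis by (simp add: dist_norm inner_diff_left)
      qed
      have 2: "dist x x' \<le> dist (x, y) (x', y')" "dist y y' \<le> dist (x, y) (x', y')" for y y'
        using dist_fst_le[of "(x, y)" "(x', y')"] dist_snd_le[of "(x, y)" "(x', y')"] by auto
      \<comment> \<open>In the first case for \<open>R\<close> the label of \<open>x'\<close> is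
        \<open>b'\<close>: if \<open>x\<close> is labelled \<open>a\<close>, the labels are
        \<open>s\<close> apart; if it is labelled \<open>b\<close>, then
        \<open>x \<bullet> e > c\<close> and the base points are. The second case exchanges the
        roles.\<close>
      show ?thesis
        using R that s 1 2[of "cut_map e c a b x" "cut_map w c' a' b' x'"]
        by (force simp: cut_map_def split: if_splits)
    qed
    have "ennreal (s\<^sup>2) * emeasure \<rho> R \<le> (\<integral>\<^sup>+ (p, q). ennreal ((dist p q)\<^sup>2) \<partial>\<pi>)"
      by (rule coupling_cost_ge[OF S cm cm _ far _ \<pi>]) (use S s assms(3) in auto)
    then show "ennreal ((s * sqrt (measure \<rho> R))\<^sup>2) \<le> (\<integral>\<^sup>+ (p, q). ennreal ((dist p q)\<^sup>2) \<partial>\<pi>)"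
      by (simp add: power_mult_distrib emeasure_eq_measure ennreal_mult)
  next
    \<comment> \<open>The coupling that keeps the base point changes only the label, by at most
      \<open>M\<close>; this supplies the finite cost asked for by
      \<open>le_wasserstein2\<close>.\<close>
    define M where "M = max (dist a a') (max (dist a b') (max (dist b a') (dist b b')))"
    have "(\<integral>\<^sup>+ x. ennreal ((dist (x, cut_map e c a b x) (x, cut_map w c' a' b' x))\<^sup>2) \<partial>\<rho>)
      \<le> (\<integral>\<^sup>+ x. ennreal (M\<^sup>2) \<partial>\<rho>)"
      by (intro nn_integral_mono ennreal_leI power_mono) (auto simp: cut_map_def M_def dist_Pair_Pair)
    also have "\<dots> < \<infinity>" by (simp add: emeasure_space_1)
    finally show "(\<integral>\<^sup>+ (p, q). ennreal ((dist p q)\<^sup>2)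
        \<partial>distr \<rho> (distr \<rho> borel (\<lambda>x. (x, cut_map e c a b x)) \<Otimes>\<^sub>M distr \<rho> borel (\<lambda>x. (x, cut_map w c' a' b' x)))
          (\<lambda>x. ((x, cut_map e c a b x), (x, cut_map w c' a' b' x)))) < \<infinity>"
      by (subst nn_integral_distr_pair_cost[OF pm pm])
  qed
qed

text \<open>For fixed \<open>x \<bullet> e\<close>, the offset \<open>(x \<bullet> (e + \<epsilon> u) - c) - (x \<bullet> e - x0 \<bullet> e)\<close> has slope \<open>\<epsilon>\<close> in the
  direction \<open>u\<close>, so whatever \<open>c\<close> is, it has absolute value at least \<open>\<epsilon> r / 2\<close> on one of the two
  sides of \<open>x0\<close>.\<close>
lemma exists_box_between_hyperplanes:
  fixes x0 :: "'a::euclidean_space"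
  assumes eu: "e \<in> Basis" "u \<in> Basis" "e \<noteq> u" and r: "r > 0" and \<epsilon>: "0 < \<epsilon>" "\<epsilon> \<le> 1"
  obtains R where "R \<in> sets borel" "R \<subseteq> cbox (x0 - r *\<^sub>R One) (x0 + r *\<^sub>R One)"
    "measure lborel R = \<epsilon> * r / 8 * (r / 2) ^ (DIM('a) - 1)"
    "(\<forall>x\<in>R. x \<bullet> (e + \<epsilon> *\<^sub>R u) > c \<and> x \<bullet> e \<le> x0 \<bullet> e - \<epsilon> * r / 8) \<or>
     (\<forall>x\<in>R. x \<bullet> (e + \<epsilon> *\<^sub>R u) \<le> c \<and> x \<bullet> e \<ge> x0 \<bullet> e + \<epsilon> * r / 8)"
proof -
  define \<delta> where "\<delta> = \<epsilon> * r / 8"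
  have er: "0 < \<delta>" "8 * \<delta> \<le> r" and half: "\<epsilon> * (r / 2) = 4 * \<delta>"
    using r \<epsilon> by (auto simp: \<delta>_def)
  define D where "D = (\<Sum>i\<in>Basis. (if i = e then \<delta> else r / 2) *\<^sub>R i)"
  have D: "D \<bullet> i = (if i = e then \<delta> else r / 2)" if "i \<in> Basis" for i
    using that by (simp add: D_def)
  have vol: "measure lborel (cbox l (l + D)) = \<delta> * (r / 2) ^ (DIM('a) - 1)" for l
  proof -
    have "measure lborel (cbox l (l + D)) = (\<Prod>i\<in>Basis. D \<bullet> i)"
      using D er r by (subst content_cbox) (auto simp: inner_add_left)
    also have "\<dots> = (\<Prod>i\<in>Basis. if i = e then \<delta> else r / 2)"
      by (intro prod.cong refl D)
    also have "\<dots> = \<delta> * (\<Prod>i\<in>Basis - {e}. r / 2)"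
      using eu(1) by (subst prod.remove[of _ e]) auto
    finally show ?thesis using eu(1) by (simp add: card_Diff_singleton)
  qed
  \<comment> \<open>This is \<open>x \<bullet> (e + \<epsilon> *\<^sub>R u) - c\<close> at
    \<open>x = x0\<close>: its sign tells to which side along \<open>u\<close> the box must be
    moved.\<close>
  let ?q = "\<epsilon> * (x0 \<bullet> u) + x0 \<bullet> e - c"
  have q: "x \<bullet> (e + \<epsilon> *\<^sub>R u) = c + ?q + (x \<bullet> e - x0 \<bullet> e) + \<epsilon> * (x \<bullet> u - x0 \<bullet> u)" for x
    by (simp add: inner_add_right algebra_simps)
  note that = that[folded \<delta>_def]
  show ?thesis
  proof (cases "?q \<ge> 0")
    case True
    \<comment> \<open>Relative to \<open>x0\<close>, the box runs from \<open>-2 * \<delta>\<close>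
      to \<open>-\<delta>\<close> along \<open>e\<close> and from \<open>r / 2\<close> to
      \<open>r\<close> along \<open>u\<close>: the tilt gains at least \<open>4 * \<delta>\<close>,
      which beats the loss of at most \<open>2 * \<delta>\<close>.\<close>
    let ?l = "x0 - (2 * \<delta>) *\<^sub>R e + (r / 2) *\<^sub>R u"
    have l: "?l \<bullet> i = x0 \<bullet> i - (if i = e then 2 * \<delta> else 0) + (if i = u then r / 2 else 0)"
      if "i \<in> Basis" for i
      using that eu by (auto simp: inner_simps inner_Basis)
    have lh: "?l \<bullet> i \<le> x \<bullet> i \<and> x \<bullet> i \<le> ?l \<bullet> i + D \<bullet> i" if "x \<in> cbox ?l (?l + D)" "i \<in> Basis" for i x
      using that by (auto simp: mem_box inner_add_left)
    show ?thesis
    proof (rule that[of "cbox ?l (?l + D)"])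
      show "cbox ?l (?l + D) \<subseteq> cbox (x0 - r *\<^sub>R One) (x0 + r *\<^sub>R One)"
      proof
        fix x assume x: "x \<in> cbox ?l (?l + D)"
        show "x \<in> cbox (x0 - r *\<^sub>R One) (x0 + r *\<^sub>R One)"
          unfolding mem_box
        proof
          fix i :: 'a assume i: "i \<in> Basis"
          have "x0 \<bullet> i - r \<le> x \<bullet> i \<and> x \<bullet> i \<le> x0 \<bullet> i + r"
            using lh[OF x i] er r eu unfolding l[OF i] D[OF i] by (cases "i = e"; cases "i = u") auto
          then show "(x0 - r *\<^sub>R One) \<bullet> i \<le> x \<bullet> i \<and> x \<bullet> i \<le> (x0 + r *\<^sub>R One) \<bullet> i"
            using i by (simp add: inner_simps)
        qed
      qed
      have "x \<bullet> (e + \<epsilon> *\<^sub>R u) > c \<and> x \<bullet> e \<le> x0 \<bullet> e - \<delta>" if x: "x \<in> cbox ?l (?l + D)" for x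
      proof -
        have "x \<bullet> e - x0 \<bullet> e \<ge> - (2 * \<delta>)" "x \<bullet> e \<le> x0 \<bullet> e - \<delta>" "x \<bullet> u - x0 \<bullet> u \<ge> r / 2"
          using lh[OF x eu(1)] lh[OF x eu(2)] eu(3)
          unfolding l[OF eu(1)] l[OF eu(2)] D[OF eu(1)] D[OF eu(2)] by auto
        moreover have "\<epsilon> * (x \<bullet> u - x0 \<bullet> u) \<ge> \<epsilon> * (r / 2)"
          using calculation(3) \<epsilon> by (intro mult_left_mono) auto
        ultimately show ?thesis using True er half unfolding q[of x] by linarith
      qed
      then show "(\<forall>x\<in>cbox ?l (?l + D). x \<bullet> (e + \<epsilon> *\<^sub>R u) > c \<and> x \<bullet> e \<le> x0 \<bullet> e - \<delta>) \<or>
        (\<forall>x\<in>cbox ?l (?l + D). x \<bullet> (e + \<epsilon> *\<^sub>R u) \<le> c \<and> x \<bullet> e \<ge> x0 \<bullet> e + \<delta>)" by blast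
    qed (use vol in auto)
  next
    case False
    \<comment> \<open>Now the box runs from \<open>\<delta>\<close> to \<open>2 * \<delta>\<close>
      along \<open>e\<close> and from \<open>-r\<close> to \<open>-r / 2\<close> along
      \<open>u\<close>, with the opposite balance.\<close>
    let ?l = "x0 + (\<delta>) *\<^sub>R e - r *\<^sub>R u"
    have l: "?l \<bullet> i = x0 \<bullet> i + (if i = e then \<delta> else 0) - (if i = u then r else 0)"
      if "i \<in> Basis" for i
      using that eu by (auto simp: inner_simps inner_Basis)
    have lh: "?l \<bullet> i \<le> x \<bullet> i \<and> x \<bullet> i \<le> ?l \<bullet> i + D \<bullet> i" if "x \<in> cbox ?l (?l + D)" "i \<in> Basis" for i x
      using that by (auto simp: mem_box inner_add_left)
    show ?thesis
    proof (rule that[of "cbox ?l (?l + D)"])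
      show "cbox ?l (?l + D) \<subseteq> cbox (x0 - r *\<^sub>R One) (x0 + r *\<^sub>R One)"
      proof
        fix x assume x: "x \<in> cbox ?l (?l + D)"
        show "x \<in> cbox (x0 - r *\<^sub>R One) (x0 + r *\<^sub>R One)"
          unfolding mem_box
        proof
          fix i :: 'a assume i: "i \<in> Basis"
          have "x0 \<bullet> i - r \<le> x \<bullet> i \<and> x \<bullet> i \<le> x0 \<bullet> i + r"
            using lh[OF x i] er r eu unfolding l[OF i] D[OF i] by (cases "i = e"; cases "i = u") auto
          then show "(x0 - r *\<^sub>R One) \<bullet> i \<le> x \<bullet> i \<and> x \<bullet> i \<le> (x0 + r *\<^sub>R One) \<bullet> i"
            using i by (simp add: inner_simps)
        qed
      qed
      have "x \<bullet> (e + \<epsilon> *\<^sub>R u) \<le> c \<and> x \<bullet> e \<ge> x0 \<bullet> e + \<delta>" if x: "x \<in> cbox ?l (?l + D)" for x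
      proof -
        have "x \<bullet> e - x0 \<bullet> e \<le> 2 * \<delta>" "x \<bullet> e \<ge> x0 \<bullet> e + \<delta>" "x \<bullet> u - x0 \<bullet> u \<le> - (r / 2)"
          using lh[OF x eu(1)] lh[OF x eu(2)] eu(3)
          unfolding l[OF eu(1)] l[OF eu(2)] D[OF eu(1)] D[OF eu(2)] by auto
        moreover have "\<epsilon> * (x \<bullet> u - x0 \<bullet> u) \<le> \<epsilon> * - (r / 2)"
          using calculation(3) \<epsilon> by (intro mult_left_mono) auto
        ultimately show ?thesis using False er half unfolding q[of x] by linarith
      qed
      then show "(\<forall>x\<in>cbox ?l (?l + D). x \<bullet> (e + \<epsilon> *\<^sub>R u) > c \<and> x \<bullet> e \<le> x0 \<bullet> e - \<delta>) \<or>
        (\<forall>x\<in>cbox ?l (?l + D). x \<bullet> (e + \<epsilon> *\<^sub>R u) \<le> c \<and> x \<bullet> e \<ge> x0 \<bullet> e + \<delta>)" by blast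
    qed (use vol in auto)
  qed
qed

section \<open>The uniform measure on a compact set and the choice of the parameters\<close>

lemma AE_uniform_measure_lborel_hyperplane:
  fixes w :: "'a::euclidean_space"
  assumes "K \<in> sets borel" "w \<noteq> 0"
  shows "AE x in uniform_measure lborel K. x \<bullet> w \<noteq> c"
proof -
  have "negligible {x. w \<bullet> x = c}" using assms(2) by (intro negligible_hyperplane) auto
  then have "{x. w \<bullet> x = c} \<in> null_sets lebesgue" by (simp add: negligible_iff_null_sets)
  moreover have "{x. w \<bullet> x = c} \<in> sets borel" by (intro borel_closed closed_hyperplane)
  ultimately have "{x. w \<bullet> x = c} \<in> null_sets lborel"
    by (metis null_sets_completion_iff sets_lborel)
  then have "AE x in lborel. x \<bullet> w \<noteq> c"
    by (auto dest!: AE_not_in simp: inner_commute)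
  then show ?thesis using assms(1) by (intro AE_uniform_measureI) auto
qed

lemma distr_cut_map_in_prob_measures_on:
  fixes \<rho> :: "'a::euclidean_space measure"
  assumes "prob_space \<rho>" and S: "sets \<rho> = sets borel" and "Y \<in> sets borel" "a \<in> Y" "b \<in> Y"
  shows "distr \<rho> borel (cut_map w c a b) \<in> prob_measures_on Y"
proof -
  interpret prob_space \<rho> by fact
  have cm: "cut_map w c a b \<in> borel_measurable \<rho>"
    using borel_measurable_cut_map S by (simp cong: measurable_cong_sets)
  have "cut_map w c a b -` Y \<inter> space \<rho> = space \<rho>"
    using assms(4,5) by (auto simp: cut_map_def)
  then have "emeasure (distr \<rho> borel (cut_map w c a b)) Y = 1"
    using cm assms(3) by (simp add: emeasure_distr emeasure_space_1)
  then show ?thesis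
    using prob_space_distr[OF cm] by (simp add: prob_measures_on_def)
qed

lemma exists_cube_subset:
  fixes x0 :: "'a::euclidean_space"
  assumes "x0 \<in> interior K"
  obtains r where "0 < r" "r \<le> 1" "cbox (x0 - r *\<^sub>R One) (x0 + r *\<^sub>R One) \<subseteq> K"
proof -
  obtain d where d: "d > 0" "cball x0 d \<subseteq> K"
    using assms unfolding mem_interior_cball by auto
  \<comment> \<open>The norm is at most the sum of the coordinates' absolute values, hence the
    division by the dimension. The cap 1 is for the later comparison of
    \<open>\<epsilon> * r / 8\<close> with \<open>2 * \<epsilon>\<close>.\<close>
  define r where "r = min 1 (d / DIM('a))"
  have r: "0 < r" "r \<le> 1" "DIM('a) * r \<le> d"
    using d(1) by (auto simp: r_def min_def field_simps)
  have "x \<in> cball x0 d" if x: "x \<in> cbox (x0 - r *\<^sub>R One) (x0 + r *\<^sub>R One)" for x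
  proof -
    have "norm (x - x0) \<le> (\<Sum>i\<in>Basis. \<bar>(x - x0) \<bullet> i\<bar>)" by (rule norm_le_l1)
    also have "\<dots> \<le> (\<Sum>i\<in>(Basis::'a set). r)"
      using x by (intro sum_mono) (force simp: mem_box inner_simps abs_le_iff)
    also have "\<dots> \<le> d" using r by simp
    finally show ?thesis by (simp add: dist_norm norm_minus_commute)
  qed
  then show ?thesis using that r d(2) by blast
qed

lemma plan_not_lipschitz:
  fixes K Y :: "'a::euclidean_space set"
  assumes dim: "DIM('a) \<ge> 2"
    and K: "compact K" "interior K \<noteq> {}" and \<rho>: "\<rho> = uniform_measure lborel K"
    and Y: "compact Y" "interior Y \<noteq> {}" and C: "C > 0"
  shows "\<exists>\<mu>0 \<in> prob_measures_on Y. \<exists>\<mu>1 \<in> prob_measures_on Y.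
    C * wasserstein2 \<mu>0 \<mu>1 < wasserstein2 (optimal_plan \<rho> \<mu>0) (optimal_plan \<rho> \<mu>1)"
proof -
  \<comment> \<open>The tilt needs a second direction orthogonal to \<open>e\<close>; here the
    dimension assumption enters.\<close>
  obtain e u :: 'a where eu: "e \<in> Basis" "u \<in> Basis" "e \<noteq> u"
    using dim by (metis card_2_iff' ex_card subsetD)
  have ort: "e \<bullet> u = 0" "u \<bullet> e = 0" "e \<bullet> e = 1" "u \<bullet> u = 1" using eu by (auto simp: inner_Basis)
  obtain x0 where "x0 \<in> interior K" using K by auto
  then obtain r where r: "0 < r" "r \<le> 1" and cube: "cbox (x0 - r *\<^sub>R One) (x0 + r *\<^sub>R One) \<subseteq> K"
    by (rule exists_cube_subset)
  have Kb: "K \<in> sets borel" using K(1) by (intro borel_closed compact_imp_closed)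
  have Kfin: "emeasure lborel K < \<infinity>" using K(1) by (rule emeasure_compact_finite)
  then have Kf: "K \<in> fmeasurable lborel" using Kb by (auto intro: fmeasurableI)
  have vol: "measure lborel (cbox l (l + t *\<^sub>R One)) = t ^ DIM('a)" if "t > 0" for l :: 'a and t
    using that by (subst content_cbox) (auto simp: inner_simps)
  \<comment> \<open>One cube on each side of the cut through \<open>x0\<close> shows
    \<open>0 < m < 1\<close>. The second starts at \<open>r / 2\<close> to avoid the cut itself. The
    first also gives \<open>V > 0\<close>.\<close>
  have sub: "cbox (x0 - r *\<^sub>R One) (x0 - r *\<^sub>R One + r *\<^sub>R One) \<subseteq> K"
      "cbox (x0 + (r/2) *\<^sub>R One) (x0 + (r/2) *\<^sub>R One + (r/2) *\<^sub>R One) \<subseteq> K"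
    by (rule subset_trans[OF _ cube], use r in \<open>simp add: subset_box inner_simps\<close>)+
  define V where "V = measure lborel K"
  have "r ^ DIM('a) \<le> V"
    using measure_mono_fmeasurable[OF sub(1) _ Kf] unfolding vol[OF r(1)] V_def by simp
  then have V: "V > 0" using r by (meson less_le_trans zero_less_power)
  then have K0: "emeasure lborel K \<noteq> 0" "emeasure lborel K \<noteq> \<infinity>"
    using Kfin by (auto simp: V_def measure_def)
  have P: "prob_space \<rho>" unfolding \<rho> by (rule prob_space_uniform_measure[OF K0])
  then interpret prob_space \<rho> .
  have S: "sets \<rho> = sets borel" by (simp add: \<rho>)
  have sp: "space \<rho> = UNIV" using sets_eq_imp_space_eq[OF S] by simp
  have m\<rho>: "measure \<rho> R = measure lborel R / V" if "R \<in> sets borel" "R \<subseteq> K" for R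
    unfolding \<rho> using that K0 by (simp add: V_def Int_absorb1)
  obtain B where "\<forall>x\<in>K. norm x \<le> B" using compact_imp_bounded[OF K(1)] bounded_iff by blast
  then have bdd: "AE x in \<rho>. norm x \<le> B" unfolding \<rho> using Kb by (intro AE_uniform_measureI) auto
  have off: "AE x in \<rho>. x \<bullet> w \<noteq> c" if "w \<noteq> 0" for w c
    unfolding \<rho> using Kb that by (rule AE_uniform_measure_lborel_hyperplane)
  define c0 where "c0 = x0 \<bullet> e"
  define m where "m = measure \<rho> {x. x \<bullet> e \<le> c0}"
  have half: "{x. x \<bullet> e \<le> c0} \<in> sets \<rho>"
    unfolding S by measurable
  have "0 < measure \<rho> (cbox (x0 - r *\<^sub>R One) (x0 - r *\<^sub>R One + r *\<^sub>R One))"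
    unfolding m\<rho>[OF borel_closed[OF closed_cbox] sub(1)] vol[OF r(1)] using r V by simp
  also have "\<dots> \<le> m"
    unfolding m_def using eu(1) half
    by (intro finite_measure_mono) (auto simp: mem_box c0_def inner_simps)
  finally have m0: "0 < m" .
  have "0 < measure \<rho> (cbox (x0 + (r/2) *\<^sub>R One) (x0 + (r/2) *\<^sub>R One + (r/2) *\<^sub>R One))"
    using sub(2) r V by (subst m\<rho>) (auto simp: vol)
  also have "\<dots> \<le> measure \<rho> (space \<rho> - {x. x \<bullet> e \<le> c0})"
    using sets.compl_sets[OF half] eu(1) r
    by (intro finite_measure_mono) (force simp: sp mem_box c0_def inner_simps)+
  also have "\<dots> = 1 - m" unfolding m_def using half by (rule prob_compl)
  finally have m1: "m < 1" by simp

  obtain y0 \<eta> where \<eta>: "\<eta> > 0" "cball y0 \<eta> \<subseteq> Y"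
    using Y(2) by (auto simp: mem_interior_cball)
  \<comment> \<open>With this \<open>k\<close> the squared lower bound for the plans is
    \<open>k * \<epsilon> ^ 3\<close>, against the upper bound
    \<open>C\<^sup>2 * \<epsilon> ^ 4\<close> for the targets.\<close>
  define k where "k = (r / 8)\<^sup>2 * (r / 8 * (r / 2) ^ (DIM('a) - 1)) / V"
  have k: "k > 0" using r V by (simp add: k_def)
  \<comment> \<open>The bound \<open>\<eta> / 2\<close> keeps the four target points in
    \<open>Y\<close>, as \<open>norm w\<close> is at most 2; the last bound makes
    \<open>C\<^sup>2 * \<epsilon>\<close> at most \<open>k / 2\<close>.\<close>
  define \<epsilon> where "\<epsilon> = min 1 (min (\<eta> / 2) (k / (2 * C\<^sup>2)))"
  have \<epsilon>: "0 < \<epsilon>" "\<epsilon> \<le> 1" "2 * \<epsilon> \<le> \<eta>" "C\<^sup>2 * \<epsilon> < k"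
  proof -
    show "0 < \<epsilon>" "\<epsilon> \<le> 1" "2 * \<epsilon> \<le> \<eta>" using \<eta> k C by (auto simp: \<epsilon>_def)
    have "C\<^sup>2 * \<epsilon> \<le> C\<^sup>2 * (k / (2 * C\<^sup>2))" by (intro mult_left_mono) (auto simp: \<epsilon>_def)
    also have "\<dots> < k" using C k by simp
    finally show "C\<^sup>2 * \<epsilon> < k" .
  qed
  define w where "w = e + \<epsilon> *\<^sub>R u"
  have we: "w \<bullet> e = 1" by (simp add: w_def inner_simps ort)
  then have w0: "w \<noteq> 0" "e \<noteq> 0" by auto
  \<comment> \<open>The level of the tilted cut is adjusted so that both targets carry the weights
    \<open>m\<close> and \<open>1 - m\<close>.\<close>
  obtain c1 where c1: "measure \<rho> {x \<in> space \<rho>. x \<bullet> w \<le> c1} = m"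
    using exists_halfspace_measure[OF P S off[OF w0(1)] m0 m1] .
  obtain R where R: "R \<in> sets borel" "R \<subseteq> cbox (x0 - r *\<^sub>R One) (x0 + r *\<^sub>R One)"
    "measure lborel R = \<epsilon> * r / 8 * (r / 2) ^ (DIM('a) - 1)"
    "(\<forall>x\<in>R. x \<bullet> w > c1 \<and> x \<bullet> e \<le> c0 - \<epsilon> * r / 8) \<or> (\<forall>x\<in>R. x \<bullet> w \<le> c1 \<and> x \<bullet> e \<ge> c0 + \<epsilon> * r / 8)"
    using exists_box_between_hyperplanes[OF eu r(1) \<epsilon>(1,2)] unfolding w_def c0_def by metis
  define a b a' b' where "a = y0 - \<epsilon> *\<^sub>R e" and "b = y0 + \<epsilon> *\<^sub>R e"
    and "a' = y0 - \<epsilon> *\<^sub>R w" and "b' = y0 + \<epsilon> *\<^sub>R w"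
  note ab = a_def b_def a'_def b'_def
  have "norm w \<le> norm e + norm (\<epsilon> *\<^sub>R u)" unfolding w_def by (rule norm_triangle_ineq)
  then have nw: "norm w \<le> 2" using \<epsilon> eu by simp
  have "\<epsilon> * norm w \<le> \<eta>" using mult_left_mono[OF nw, of \<epsilon>] \<epsilon> by linarith
  then have "a \<in> Y" "b \<in> Y" "a' \<in> Y" "b' \<in> Y"
    using \<eta>(2) \<epsilon> eu(1) by (auto simp: ab dist_norm intro!: subsetD[OF \<eta>(2)])
  define \<mu>0 \<mu>1 where "\<mu>0 = distr \<rho> borel (cut_map e c0 a b)" and "\<mu>1 = distr \<rho> borel (cut_map w c1 a' b')"
  have Yb: "Y \<in> sets borel" using Y(1) by (intro borel_closed compact_imp_closed)
  have in_Y: "\<mu>0 \<in> prob_measures_on Y" "\<mu>1 \<in> prob_measures_on Y"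
    unfolding \<mu>0_def \<mu>1_def by (intro distr_cut_map_in_prob_measures_on P S Yb; fact)+
  have tb: "2 * \<epsilon> > 0" "b = a + (2 * \<epsilon>) *\<^sub>R e" "b' = a' + (2 * \<epsilon>) *\<^sub>R w"
    using \<epsilon> by (auto simp: ab algebra_simps simp flip: scaleR_add_left)
  have plan0: "optimal_plan \<rho> \<mu>0 = distr \<rho> borel (\<lambda>x. (x, cut_map e c0 a b x))"
    by (rule optimal_plan_cut_map[OF P S bdd off[OF w0(2)] tb(1,2) \<mu>0_def])
  have plan1: "optimal_plan \<rho> \<mu>1 = distr \<rho> borel (\<lambda>x. (x, cut_map w c1 a' b' x))"
    by (rule optimal_plan_cut_map[OF P S bdd off[OF w0(1)] tb(1,3) \<mu>1_def])
  have "wasserstein2 \<mu>0 \<mu>1 \<le> \<epsilon>\<^sup>2"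
    unfolding \<mu>0_def \<mu>1_def
  proof (rule wasserstein2_two_point_le[OF P S])
    show "measure \<rho> {x. x \<bullet> e \<le> c0} = measure \<rho> {x. x \<bullet> w \<le> c1}"
      using c1 by (simp add: sp m_def)
    \<comment> \<open>Corresponding points differ by \<open>\<epsilon> *\<^sub>R (w - e)\<close> up
      to sign, which is \<open>\<epsilon>\<^sup>2 *\<^sub>R u\<close>.\<close>
    show "dist a a' \<le> \<epsilon>\<^sup>2" "dist b b' \<le> \<epsilon>\<^sup>2"
      using eu \<epsilon> by (simp_all add: ab w_def dist_norm algebra_simps power2_eq_square)
  qed
  then have "C * wasserstein2 \<mu>0 \<mu>1 \<le> C * \<epsilon>\<^sup>2" using C by (intro mult_left_mono) auto
  also have "C * \<epsilon>\<^sup>2 < \<epsilon> * r / 8 * sqrt (measure \<rho> R)"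
  proof (rule power2_less_imp_less)
    have "(C * \<epsilon>\<^sup>2)\<^sup>2 = C\<^sup>2 * \<epsilon> * \<epsilon> ^ 3" by (simp add: power_mult_distrib power_numeral_reduce algebra_simps)
    also have "\<dots> < k * \<epsilon> ^ 3" using \<epsilon> by (intro mult_strict_right_mono) auto
    also have "k * \<epsilon> ^ 3 = (\<epsilon> * r / 8)\<^sup>2 * (\<epsilon> * r / 8 * (r / 2) ^ (DIM('a) - 1) / V)"
      by (simp add: k_def power_numeral_reduce)
    also have "\<dots> = (\<epsilon> * r / 8)\<^sup>2 * measure \<rho> R"
      unfolding m\<rho>[OF R(1) subset_trans[OF R(2) cube]] R(3) by simp
    also have "\<dots> = (\<epsilon> * r / 8 * sqrt (measure \<rho> R))\<^sup>2"
      unfolding power_mult_distrib[of "\<epsilon> * r / 8"] by simp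
    finally show "(C * \<epsilon>\<^sup>2)\<^sup>2 < (\<epsilon> * r / 8 * sqrt (measure \<rho> R))\<^sup>2" .
    show "0 \<le> \<epsilon> * r / 8 * sqrt (measure \<rho> R)" using \<epsilon> r by simp
  qed
  also have "\<dots> \<le> wasserstein2 (optimal_plan \<rho> \<mu>0) (optimal_plan \<rho> \<mu>1)"
    unfolding plan0 plan1
  proof (rule wasserstein2_cut_plans_ge[OF P S R(1) _ _ _ _ R(4)])
    \<comment> \<open>Since \<open>w \<bullet> e = 1\<close>, the differences \<open>a - b'\<close>
      and \<open>b - a'\<close> have component of size exactly \<open>2 * \<epsilon>\<close> along
      \<open>e\<close>.\<close>
    have far: "\<epsilon> * r / 8 \<le> norm z" if "\<bar>z \<bullet> e\<bar> = 2 * \<epsilon>" for z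
    proof -
      have "\<epsilon> * r \<le> \<epsilon> * 1" using \<epsilon> r by (intro mult_left_mono) auto
      moreover have "2 * \<epsilon> \<le> norm z" using Basis_le_norm[OF eu(1), of z] that by simp
      ultimately show ?thesis using \<epsilon> by linarith
    qed
    show "\<epsilon> * r / 8 \<le> dist a b'" "\<epsilon> * r / 8 \<le> dist b a'"
      unfolding dist_norm by (rule far, use \<epsilon> we ort in \<open>simp add: ab inner_simps\<close>)+
  qed (use \<epsilon> r eu in auto)
  finally show ?thesis using in_Y by blast
qed

theorem proposition1p5:
  fixes K Y :: "(real ^ 'n) set" and \<rho> :: "(real ^ 'n) measure"
  assumes "CARD('n) \<ge> 2"
    and "compact K" and "interior K \<noteq> {}" and "\<rho> = uniform_measure lborel K"
    and "compact Y" and "interior Y \<noteq> {}"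
  shows "\<not> (\<exists>C::real. C > 0 \<and>
    (\<forall>\<mu>0 \<in> prob_measures_on Y. \<forall>\<mu>1 \<in> prob_measures_on Y.
       wasserstein2 (optimal_plan \<rho> \<mu>0) (optimal_plan \<rho> \<mu>1) \<le> C * wasserstein2 \<mu>0 \<mu>1))"
  using plan_not_lipschitz[OF _ assms(2-6)] assms(1) by (force simp: not_le)

end
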